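(* Let $m\ge1$ and let ${\bf\Psi}_r^{(m)}=(\Psi_{r,1},\dots,\Psi_{r,m})$ (defined for all sufficiently large $r$), where $$\Psi_{r,k}=\frac{\mathscr{F}_r^{(m,m-2k+1)}}{\mathscr{F}_r^{(m,m-k+1)}}\ \text{ for }1\le k\le\lfloor m/2\rfloor,\qquad \Psi_{r,k}=\frac{-\mathscr{F}_r^{(m,2k-m)}}{\mathscr{F}_r^{(m,m-k+1)}}\ \text{ for }\lfloor m/2\rfloor+1\le k\le m .$$ Then $\lim_{r\to\infty}{\bf\Psi}_r^{(m)}$ is the vector whose $k$-th coordinate is $$\frac{\mu_{m\,(m-2k+1)}-\mu_{m\,(m-2k)}}{\mu_{m\,(m-k+1)}-\mu_{m\,(m-k)}}\ \text{ for }1\le k\le\lfloor m/2\rfloor,\qquad \frac{-(\mu_{m\,(2k-m)}-\mu_{m\,(2k-m-1)})}{\mu_{m\,(m-k+1)}-\mu_{m\,(m-k)}}\ \text{ for }\lfloor m/2\rfloor+1\le k\le m,$$ and this vector equals ${\bf\Phi}^{(m)}=(\phi_{m\,1},\phi_{m\,2},\dots,\phi_{m\,m})$. Consequently $$\lim_{r\to\infty}\prod_{k=1}^m\left(x^2-\Psi_{r,k}\,x+1\right)=x^{2m}+x^{2m-1}+\dots+x+1,$$ and the same holds with every $\mathscr{F}_r^{(m,j)}$ replaced by $\mathscr{N}_r^{(m,j)}$.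
   Context: For all integers $k$ set $\phi_{m\,k}=2\cos\left(\frac{2\pi k}{2m+1}\right)$ and $\mu_{m\,k}=\phi_{m\,k}-2$. Rational interlacing Fibonacci sequences of dimension $m\ge1$. Let $h_k=\frac1{2k+1}\binom{m+k}{2k}$ and let $R_m$ be the $m\times m$ matrix whose first column is $(-h_1,-h_2,\dots,-h_m)^T$, whose entries $(i,i+1)$, $1\le i\le m-1$, equal $1$, and whose other entries are $0$. Let $B_{\rm odd}$ be the $m\times m$ matrix with $(i,j)$ entry $(-1)^{i+j-1}\binom{2j-1}{j-i}$ (binomial coefficients with negative lower entry are $0$). For $r\in\mathbb{Z}$ and $1\le j\le m$, $\mathscr{F}_r^{(m,j)}$ is the $(j,1)$ entry of $(2m+1)B_{\rm odd}R_m^{r}$. For $r>0$ the non-reduced numerators are $\mathscr{N}_r^{(m,j)}=\left(\prod_{i}p_i^{\lfloor (r-1)/q_i\rfloor}\right)\mathscr{F}_r^{(m,j)}$, where $p_i=2q_i+1$ runs over the distinct prime factors of $2m+1$. Convergence is in the Euclidean norm of $\mathbb{R}^m$ (coefficientwise for polynomials in $x$). *)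

theory Defs
  imports
    "HOL-Analysis.L2_Norm"
    "HOL-Computational_Algebra.Polynomial"
    "HOL-Computational_Algebra.Primes"
    "Jordan_Normal_Form.Gauss_Jordan_Elimination"
begin

definition phi :: "nat \<Rightarrow> int \<Rightarrow> real" where
  "phi m k = 2 * cos (2 * pi * of_int k / (2 * real m + 1))"

definition mu :: "nat \<Rightarrow> int \<Rightarrow> real" where
  "mu m k = phi m k - 2"

definition h :: "nat \<Rightarrow> nat \<Rightarrow> real" where
  "h m k = real ((m + k) choose (2 * k)) / real (2 * k + 1)"

text \<open>Matrices have 0-based indices; \<open>entry_mat m f\<close> is the \<open>m\<close> by \<open>m\<close> matrix
  whose entry in row \<open>i\<close> and column \<open>j\<close>, counted from 1, is \<open>f i j\<close>.\<close>

definition entry_mat :: "nat \<Rightarrow> (nat \<Rightarrow> nat \<Rightarrow> real) \<Rightarrow> real mat" where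
  "entry_mat m f = mat m m (\<lambda>(a, b). f (a + 1) (b + 1))"

definition R_mat :: "nat \<Rightarrow> real mat" where
  "R_mat m = entry_mat m (\<lambda>i j. if j = 1 then - h m i else if j = i + 1 then 1 else 0)"

text \<open>The case distinction gives binomial coefficients with negative lower entry the value 0
  (subtraction on \<^typ>\<open>nat\<close> is truncated).\<close>

definition B_odd :: "nat \<Rightarrow> real mat" where
  "B_odd m = entry_mat m (\<lambda>i j.
     if i \<le> j then (- 1) ^ (i + j - 1) * real ((2 * j - 1) choose (j - i)) else 0)"

text \<open>Only meaningful for negative exponents if the matrix is invertible, which holds for
  \<^const>\<open>R_mat\<close> since \<open>h m m = 1 / (2 * m + 1)\<close>.\<close>

definition mat_powi :: "real mat \<Rightarrow> int \<Rightarrow> real mat" where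
  "mat_powi A r =
     (if 0 \<le> r then A ^\<^sub>m nat r else the (mat_inverse A) ^\<^sub>m nat (- r))"

text \<open>The upper index \<open>j\<close> of \<open>fibF m r j\<close> and \<open>fibN m r j\<close> runs over \<open>{1..m}\<close>.\<close>

definition fibF :: "nat \<Rightarrow> int \<Rightarrow> nat \<Rightarrow> real" where
  "fibF m r j =
     (real (2 * m + 1) \<cdot>\<^sub>m (B_odd m * mat_powi (R_mat m) r)) $$ (j - 1, 0)"

text \<open>Non-reduced numerators, for \<open>r > 0\<close>. All primes \<open>p\<close> involved are odd, so
  \<open>(p - 1) div 2\<close> is the \<open>q\<close> with \<open>p = 2 * q + 1\<close>.\<close>

definition fibN :: "nat \<Rightarrow> int \<Rightarrow> nat \<Rightarrow> real" where
  "fibN m r j =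
     (\<Prod>p\<in>prime_factors (2 * m + 1). real p ^ nat ((r - 1) div int ((p - 1) div 2))) * fibF m r j"

text \<open>The sequence \<open>G\<close> is meant to be \<open>fibF m\<close> or \<open>fibN m\<close>. For \<open>k \<in> {1..m}\<close> no subtraction
  on \<^typ>\<open>nat\<close> is truncated.\<close>

definition Psi :: "nat \<Rightarrow> (int \<Rightarrow> nat \<Rightarrow> real) \<Rightarrow> int \<Rightarrow> nat \<Rightarrow> real" where
  "Psi m G r k =
     (if k \<le> m div 2 then G r (m - 2 * k + 1) / G r (m - k + 1)
      else - G r (2 * k - m) / G r (m - k + 1))"

definition Psi_lim :: "nat \<Rightarrow> nat \<Rightarrow> real" where
  "Psi_lim m k =
     (if k \<le> m div 2
      then (mu m (int m - 2 * int k + 1) - mu m (int m - 2 * int k))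
         / (mu m (int m - int k + 1) - mu m (int m - int k))
      else - (mu m (2 * int k - int m) - mu m (2 * int k - int m - 1))
         / (mu m (int m - int k + 1) - mu m (int m - int k)))"

text \<open>Points of \<open>m\<close>-dimensional Euclidean space are functions restricted to \<open>{1..m}\<close>;
  \<^const>\<open>L2_set\<close> over \<open>{1..m}\<close> is the Euclidean norm.\<close>

definition eucl_lim :: "nat \<Rightarrow> (nat \<Rightarrow> nat \<Rightarrow> real) \<Rightarrow> (nat \<Rightarrow> real) \<Rightarrow> bool" where
  "eucl_lim m X L \<longleftrightarrow> (\<lambda>r. L2_set (\<lambda>k. X r k - L k) {1..m}) \<longlonglongrightarrow> 0"

definition coeffwise_lim :: "(nat \<Rightarrow> real poly) \<Rightarrow> real poly \<Rightarrow> bool" where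
  "coeffwise_lim P Q \<longleftrightarrow> (\<forall>i. (\<lambda>r. coeff (P r) i) \<longlonglongrightarrow> coeff Q i)"

end

theory Submission
  imports Defs
begin

text \<open>Put \<open>N = 2 * m + 1\<close> and \<open>t\<^sub>k = k * pi / N\<close>, so that \<open>mu m k = - 4 * sin\<^sup>2 t\<^sub>k\<close>. Everything rests on
  a closed form of Binet type (lemma \<open>fibF_binet\<close>), valid for \<open>r \<ge> 0\<close> and \<open>1 \<le> j \<le> m\<close>:
  \<open>fibF m r j = (\<Sum>k=1..m. (mu m (k * j) - mu m (k * (j - 1))) / mu m k ^ r)\<close>.

  The numbers \<open>h m i\<close> are, up to the factor \<open>N\<close>, the coefficients of the polynomial in
  \<open>x = - 4 * sin\<^sup>2 t\<close> that equals \<open>sin (N * t) / sin t\<close> (\<open>h_sum_sin\<close>). Hence its roots are the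
  \<open>mu m k\<close>, and since \<^const>\<open>R_mat\<close> is a companion matrix for this polynomial,
  \<open>(1, x, ..., x ^ (m - 1))\<close> with \<open>x = mu m k\<close> is a left eigenvector with eigenvalue \<open>1 / x\<close>
  (\<open>R_mat_power_left_eigenvector\<close>). This gives \<open>m\<close> linear equations for the first column of
  \<open>R_mat m ^ r\<close>. The matrix \<^const>\<open>B_odd\<close> is the change of basis between \<open>x ^ l * sin t\<close> and the
  sines of odd multiples of \<open>t\<close> (\<open>B_odd_sin\<close>). It turns the equations into a discrete sine
  transform, which the orthogonality of the sines at the nodes \<open>t\<^sub>k\<close> inverts
  (\<open>sin_nodes_orthogonal\<close>).

  In the closed form \<open>mu m 1\<close> is the denominator of smallest modulus, so the term \<open>k = 1\<close>
  dominates, and quotients of the \<open>fibF m r j\<close> converge to quotients of the differences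
  \<open>mu m j - mu m (j - 1)\<close>. Such a difference is \<open>- 4 * sin t\<^sub>1 * sin ((2 * j - 1) * t\<^sub>1)\<close>. For the indices
  in \<^const>\<open>Psi_lim\<close> the reflection \<open>N * t\<^sub>1 = pi\<close> makes the quotient \<open>sin (2 * u) / sin u = 2 * cos u\<close>
  with \<open>u = 2 * k * t\<^sub>1\<close>, which is \<open>phi m k\<close>. Finally \<open>x\<^sup>2 - phi m k * x + 1\<close> has as roots a conjugate
  pair of \<open>N\<close>-th roots of unity, and these pairs run over all of them except 1. The factor in
  \<^const>\<open>fibN\<close> does not depend on \<open>j\<close> and cancels in every quotient.\<close>

section \<open>The nodes\<close>

definition node :: "nat \<Rightarrow> nat \<Rightarrow> real" where
  "node m k = pi * real k / (2 * real m + 1)"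

lemma node_bounds:
  assumes "1 \<le> k" "k \<le> m"
  shows "0 < node m k" "node m k < pi / 2"
proof -
  have "pi * (2 * real k) < pi * (2 * real m + 1)"
    using assms by (intro mult_strict_left_mono) auto
  then show "0 < node m k" "node m k < pi / 2"
    using assms by (auto simp: node_def field_simps)
qed

lemma mu_eq_sin_node: "mu m (int k) = - 4 * (sin (node m k))\<^sup>2"
proof -
  have "2 * pi * real k / (2 * real m + 1) = 2 * node m k"
    by (simp add: node_def)
  then show ?thesis
    by (simp add: mu_def phi_def cos_double_sin)
qed

lemma mu_neg:
  assumes "1 \<le> k" "k \<le> m"
  shows "mu m (int k) < 0"
proof -
  have "0 < sin (node m k)"
    using node_bounds[OF assms] by (intro sin_gt_zero) auto
  then show ?thesis
    by (simp add: mu_eq_sin_node)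
qed

lemma mu_diff_eq_sin:
  "mu m (k * j) - mu m (k * (j - 1)) =
   - 4 * sin (pi * of_int k / (2 * real m + 1)) * sin ((2 * of_int j - 1) * (pi * of_int k / (2 * real m + 1)))"
proof -
  define t where "t = pi * of_int k / (2 * real m + 1)"
  have "2 * real m + 1 \<noteq> 0"
    by linarith
  then have "2 * pi * of_int (k * j) / (2 * real m + 1) = (2 * of_int j - 1) * t + t"
    and "2 * pi * of_int (k * (j - 1)) / (2 * real m + 1) = (2 * of_int j - 1) * t - t"
    by (simp_all add: t_def algebra_simps add_divide_distrib diff_divide_distrib)
  then show ?thesis
    unfolding mu_def phi_def t_def[symmetric] by (simp add: cos_add cos_diff)
qed

section \<open>The polynomial behind the companion matrix\<close>

text \<open>Both sums, called \<open>W n\<close> and \<open>V n\<close> in the proof, are polynomials in \<open>x\<close>. Pascal's rule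
  couples them by \<open>V (n + 1) = V n + W n\<close> and \<open>W (n + 1) = W n + x * V (n + 1)\<close>, and the trigonometric
  sides obey the same recurrences by the addition theorems. The factors \<open>cos t\<close> and
  \<open>sin (2 * t)\<close> stand on the left to avoid division by zero.\<close>

lemma binomial_sums_trig:
  fixes t :: real
  defines "x \<equiv> - 4 * (sin t)\<^sup>2"
  shows "(\<Sum>k\<le>n. real ((n + k) choose (2 * k)) * x ^ k) * cos t = cos ((2 * real n + 1) * t)
       \<and> (\<Sum>k\<le>n. real ((n + k) choose (2 * k + 1)) * x ^ k) * sin (2 * t) = sin (2 * real n * t)"
proof (induction n)
  case 0
  show ?case by simp
next
  case (Suc n)
  define W where "W = (\<lambda>n. \<Sum>k\<le>n. real ((n + k) choose (2 * k)) * x ^ k)"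
  define V where "V = (\<lambda>n. \<Sum>k\<le>n. real ((n + k) choose (2 * k + 1)) * x ^ k)"
  have V_Suc: "V (Suc n) = V n + W n"
  proof -
    have "V (Suc n) = (\<Sum>k\<le>n. real (Suc (n + k) choose (2 * k + 1)) * x ^ k)"
      by (simp add: V_def binomial_eq_0 del: binomial_Suc_Suc)
    also have "\<dots> = V n + W n"
      by (simp add: V_def W_def sum.distrib[symmetric] algebra_simps)
    finally show ?thesis .
  qed
  have W_Suc: "W (Suc n) = W n + x * V (Suc n)"
  proof -
    have "W (Suc n) = 1 + (\<Sum>k\<le>n. real ((Suc n + Suc k) choose (2 * Suc k)) * x ^ Suc k)"
      unfolding W_def by (subst sum.atMost_Suc_shift) simp
    also have "(\<Sum>k\<le>n. real ((Suc n + Suc k) choose (2 * Suc k)) * x ^ Suc k)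
       = (\<Sum>k\<le>n. real ((n + Suc k) choose (2 * Suc k)) * x ^ Suc k)
         + (\<Sum>k\<le>n. x * (real ((Suc n + k) choose (2 * k + 1)) * x ^ k))"
      unfolding sum.distrib[symmetric] by (intro sum.cong) (auto simp: algebra_simps)
    also have "(\<Sum>k\<le>n. x * (real ((Suc n + k) choose (2 * k + 1)) * x ^ k)) = x * V (Suc n)"
      by (simp add: V_def sum_distrib_left binomial_eq_0 del: binomial_Suc_Suc)
    also have "1 + ((\<Sum>k\<le>n. real ((n + Suc k) choose (2 * Suc k)) * x ^ Suc k) + x * V (Suc n))
       = (\<Sum>k\<le>Suc n. real ((n + k) choose (2 * k)) * x ^ k) + x * V (Suc n)"
      by (subst sum.atMost_Suc_shift) simp
    also have "(\<Sum>k\<le>Suc n. real ((n + k) choose (2 * k)) * x ^ k) = W n"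
      by (simp add: W_def binomial_eq_0)
    finally show ?thesis .
  qed
  have IH: "W n * cos t = cos ((2 * real n + 1) * t)" "V n * sin (2 * t) = sin (2 * real n * t)"
    using Suc.IH by (auto simp: W_def V_def)
  have Vs: "V (Suc n) * sin (2 * t) = sin (2 * real (Suc n) * t)"
  proof -
    have "V (Suc n) * sin (2 * t) = sin (2 * real n * t) + 2 * sin t * (W n * cos t)"
      unfolding V_Suc IH(2)[symmetric] sin_double by (simp add: algebra_simps)
    also have "\<dots> = sin ((2 * real n + 1) * t - t) + 2 * sin t * cos ((2 * real n + 1) * t)"
      unfolding IH(1) by (simp add: algebra_simps)
    also have "\<dots> = sin ((2 * real n + 1) * t + t)"
      by (simp only: sin_diff sin_add) simp
    finally show ?thesis by (simp add: algebra_simps)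
  qed
  have "W (Suc n) * cos t = W n * cos t - 2 * sin t * (V (Suc n) * sin (2 * t))"
    unfolding W_Suc x_def sin_double by (simp add: algebra_simps power2_eq_square)
  also have "\<dots> = cos (2 * real (Suc n) * t - t) - 2 * sin t * sin (2 * real (Suc n) * t)"
    unfolding Vs IH(1) by (simp add: algebra_simps)
  also have "\<dots> = cos (2 * real (Suc n) * t + t)"
    by (simp only: cos_diff cos_add) simp
  finally show ?case
    using Vs by (simp add: W_def V_def algebra_simps)
qed

text \<open>Removes the denominator of \<^const>\<open>h\<close>, so that sums over \<^const>\<open>h\<close> split into the two
  sums above.\<close>

lemma h_expand:
  "(2 * real m + 1) * h m k = real ((m + k) choose (2 * k)) + 2 * real ((m + k) choose (2 * k + 1))"
proof (cases "k \<le> m")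
  case True
  have "(2 * k + 1) * ((m + k) choose (2 * k + 1)) = (m + k - 2 * k) * ((m + k) choose (2 * k))"
    using binomial_absorption[of "2 * k" "m + k"] binomial_absorb_comp[of "m + k" "2 * k"] by simp
  then have "real (2 * k + 1) * real ((m + k) choose (2 * k + 1)) = real (m - k) * real ((m + k) choose (2 * k))"
    unfolding of_nat_mult[symmetric] by simp
  then show ?thesis
    using True by (simp add: h_def field_simps of_nat_diff)
next
  case False
  then show ?thesis by (simp add: h_def binomial_eq_0)
qed

text \<open>By the two lemmas above the polynomial is \<open>W + 2 * V\<close>; multiplied by \<open>sin t * cos t\<close> it becomes
  \<open>sin t * cos (N * t) + sin (N * t - t)\<close> with \<open>N = 2 * m + 1\<close>.\<close>

lemma h_sum_sin:
  assumes "cos t \<noteq> 0"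
  shows "(2 * real m + 1) * (\<Sum>k\<le>m. h m k * (- 4 * (sin t)\<^sup>2) ^ k) * sin t = sin ((2 * real m + 1) * t)"
proof -
  define x where "x = - 4 * (sin t)\<^sup>2"
  define W where "W = (\<Sum>k\<le>m. real ((m + k) choose (2 * k)) * x ^ k)"
  define V where "V = (\<Sum>k\<le>m. real ((m + k) choose (2 * k + 1)) * x ^ k)"
  have WV: "W * cos t = cos ((2 * real m + 1) * t)" "V * sin (2 * t) = sin (2 * real m * t)"
    using binomial_sums_trig[of m t] by (auto simp: W_def V_def x_def)
  have "(2 * real m + 1) * (\<Sum>k\<le>m. h m k * x ^ k) = (\<Sum>k\<le>m. ((2 * real m + 1) * h m k) * x ^ k)"
    by (simp add: sum_distrib_left mult.assoc)
  also have "\<dots> = W + 2 * V"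
    unfolding h_expand by (simp add: W_def V_def sum_distrib_left sum.distrib algebra_simps)
  finally have "(2 * real m + 1) * (\<Sum>k\<le>m. h m k * x ^ k) * sin t * cos t = (W + 2 * V) * sin t * cos t"
    by simp
  also have "\<dots> = sin t * (W * cos t) + V * sin (2 * t)"
    unfolding sin_double by (simp add: algebra_simps)
  also have "V * sin (2 * t) = sin ((2 * real m + 1) * t - t)"
    unfolding WV by (simp add: algebra_simps)
  also have "sin t * (W * cos t) + sin ((2 * real m + 1) * t - t) = sin ((2 * real m + 1) * t) * cos t"
    unfolding WV sin_diff by simp
  finally show ?thesis
    using assms by (simp add: x_def)
qed

lemma h_sum_mu_eq_0:
  assumes "1 \<le> k" "k \<le> m"
  shows "(\<Sum>i\<le>m. h m i * mu m (int k) ^ i) = 0"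
proof -
  have "sin (node m k) > 0" "cos (node m k) > 0"
    using node_bounds[OF assms] by (auto intro!: sin_gt_zero cos_gt_zero)
  moreover have "(2 * real m + 1) * node m k = real k * pi"
    by (simp add: node_def)
  ultimately show ?thesis
    using h_sum_sin[of "node m k" m] by (simp add: mu_eq_sin_node)
qed

section \<open>Eigenvectors of the companion matrix\<close>

text \<open>For a root \<open>x\<close> the row \<open>(1, x, ..., x ^ (m - 1))\<close> is multiplied by \<open>1 / x\<close>: the superdiagonal
  shifts it, and the first column contributes \<open>- (\<Sum>i=1..m. h m i * x ^ (i - 1)) = 1 / x\<close>, because
  \<open>h m 0 = 1\<close>.\<close>

lemma R_mat_power_left_eigenvector:
  fixes x :: real
  assumes root: "(\<Sum>i\<le>m. h m i * x ^ i) = 0" and "x \<noteq> 0" and "j < m"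
  shows "(\<Sum>i<m. x ^ i * (R_mat m ^\<^sub>m n) $$ (i, j)) = x ^ j / x ^ n"
  using \<open>j < m\<close>
proof (induction n arbitrary: j)
  case 0
  then show ?case
    by (simp add: R_mat_def entry_mat_def if_distrib[of "\<lambda>y. _ * y"] cong: if_cong)
next
  case (Suc n)
  have carr: "R_mat m \<in> carrier_mat m m" "R_mat m ^\<^sub>m n \<in> carrier_mat m m"
    by (auto simp: R_mat_def entry_mat_def intro!: pow_carrier_mat)
  have step: "(\<Sum>l<m. x ^ l * R_mat m $$ (l, j)) = x ^ j / x"
  proof (cases j)
    case 0
    have "(\<Sum>l<m. x ^ l * R_mat m $$ (l, j)) * x = - (\<Sum>l<m. h m (Suc l) * x ^ Suc l)"
      using 0 Suc.prems
      by (simp add: R_mat_def entry_mat_def sum_distrib_left sum_negf mult_ac)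
    also have "\<dots> = h m 0 - (\<Sum>i<Suc m. h m i * x ^ i)"
      by (subst sum.lessThan_Suc_shift) simp
    also have "\<dots> = 1"
      using root by (simp add: lessThan_Suc_atMost h_def)
    finally show ?thesis
      using 0 \<open>x \<noteq> 0\<close> by (simp add: field_simps)
  next
    case (Suc j')
    have "(\<Sum>l<m. x ^ l * R_mat m $$ (l, j)) = (\<Sum>l<m. if l = j' then x ^ l else 0)"
      using Suc Suc.prems by (intro sum.cong) (auto simp: R_mat_def entry_mat_def)
    also have "\<dots> = x ^ j'"
      using Suc \<open>j < m\<close> by simp
    finally show ?thesis
      using Suc \<open>x \<noteq> 0\<close> by simp
  qed
  have "(\<Sum>i<m. x ^ i * (R_mat m ^\<^sub>m Suc n) $$ (i, j))
      = (\<Sum>i<m. \<Sum>l<m. x ^ i * ((R_mat m ^\<^sub>m n) $$ (i, l) * R_mat m $$ (l, j)))"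
    using carr Suc.prems
    by (intro sum.cong) (auto simp: scalar_prod_def sum_distrib_left atLeast0LessThan)
  also have "\<dots> = (\<Sum>l<m. (\<Sum>i<m. x ^ i * (R_mat m ^\<^sub>m n) $$ (i, l)) * R_mat m $$ (l, j))"
    by (subst sum.swap) (simp add: sum_distrib_right mult.assoc)
  also have "\<dots> = (\<Sum>l<m. x ^ l * R_mat m $$ (l, j)) / x ^ n"
    using Suc.IH by (simp add: sum_divide_distrib)
  finally show ?case
    by (simp add: step)
qed

section \<open>The change of basis to sines of odd multiples\<close>

text \<open>Expand \<open>(2 * \<i> * sin t) ^ (2 * j + 1) = (cis t - cis (- t)) ^ (2 * j + 1)\<close> by the binomial theorem. The
  number of terms is even, and the terms \<open>l\<close> and \<open>2 * j + 1 - l\<close> have equal imaginary parts, so half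
  of the sum suffices.\<close>

lemma sin_odd_power_fold:
  fixes t :: real
  shows "(- 4 * (sin t)\<^sup>2) ^ j * sin t
       = (\<Sum>l\<le>j. (- 1) ^ l * real ((2 * j + 1) choose l) * sin (real_of_int (2 * int j + 1 - 2 * int l) * t))"
proof -
  let ?n = "2 * j + 1"
  define f where "f l = (- 1) ^ l * real (?n choose l) * sin (real_of_int (int ?n - 2 * int l) * t)" for l
  have "(2 * \<i> * complex_of_real (sin t)) ^ ?n = (- cis (- t) + cis t) ^ ?n"
    by (rule arg_cong[where f = "\<lambda>z. z ^ ?n"]) (simp add: complex_eq_iff)
  also have "\<dots> = (\<Sum>l\<le>?n. of_nat (?n choose l) * (- cis (- t)) ^ l * cis t ^ (?n - l))"
    by (rule binomial_ring)
  also have "\<dots> = (\<Sum>l\<le>?n. complex_of_real ((- 1) ^ l * real (?n choose l)) * cis (real_of_int (int ?n - 2 * int l) * t))"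
  proof (intro sum.cong refl)
    fix l assume "l \<in> {..?n}"
    then have "l \<le> ?n" by simp
    have "(- cis (- t)) ^ l = (- 1) ^ l * cis (- (real l * t))"
      by (subst power_minus) (simp add: DeMoivre)
    moreover have "cis (- (real l * t)) * cis t ^ (?n - l) = cis (real_of_int (int ?n - 2 * int l) * t)"
      using \<open>l \<le> ?n\<close> by (simp add: DeMoivre cis_mult of_nat_diff algebra_simps)
    ultimately show "of_nat (?n choose l) * (- cis (- t)) ^ l * cis t ^ (?n - l)
       = complex_of_real ((- 1) ^ l * real (?n choose l)) * cis (real_of_int (int ?n - 2 * int l) * t)"
      by (simp add: mult_ac)
  qed
  finally have "Im ((2 * \<i> * complex_of_real (sin t)) ^ ?n) = (\<Sum>l\<le>?n. f l)"
    by (simp only: Im_sum f_def Im_complex_of_real Re_complex_of_real complex.sel times_complex.sel cis.sel) simp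
  moreover have "(2 * \<i> * complex_of_real (sin t)) ^ ?n
      = \<i> * complex_of_real (2 * ((- 4 * (sin t)\<^sup>2) ^ j * sin t))"
  proof -
    have "(2 * \<i> * complex_of_real (sin t)) ^ ?n
        = ((2 * \<i> * complex_of_real (sin t))\<^sup>2) ^ j * (2 * \<i> * complex_of_real (sin t))"
      by (simp add: power_mult)
    also have "(2 * \<i> * complex_of_real (sin t))\<^sup>2 = complex_of_real (- 4 * (sin t)\<^sup>2)"
      by (simp add: power_mult_distrib)
    finally show ?thesis
      by (simp only: of_real_power[symmetric]) simp
  qed
  ultimately have "2 * ((- 4 * (sin t)\<^sup>2) ^ j * sin t) = (\<Sum>l\<le>?n. f l)"
    by (simp only: Im_i_times Re_complex_of_real)
  also have "\<dots> = (\<Sum>l\<le>j. f l) + (\<Sum>l\<in>{Suc j..?n}. f l)"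
  proof -
    have "{..?n} = {..j} \<union> {Suc j..?n}"
      by auto
    then show ?thesis
      by (simp only:) (rule sum.union_disjoint; auto)
  qed
  also have "(\<Sum>l\<in>{Suc j..?n}. f l) = (\<Sum>l\<le>j. f l)"
  proof (rule sum.reindex_bij_witness[of _ "\<lambda>l. ?n - l" "\<lambda>l. ?n - l"])
    fix l assume l: "l \<in> {Suc j..?n}"
    then have "l \<le> ?n" by simp
    have "(- 1 :: real) ^ (?n - l) = - ((- 1) ^ l)"
      using \<open>l \<le> ?n\<close> by (auto simp: minus_one_power_iff)
    moreover have "?n choose (?n - l) = ?n choose l"
      using \<open>l \<le> ?n\<close> by (metis binomial_symmetric)
    moreover have "real_of_int (int ?n - 2 * int (?n - l)) * t = - (real_of_int (int ?n - 2 * int l) * t)"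
      using \<open>l \<le> ?n\<close> by (simp add: of_nat_diff algebra_simps)
    ultimately show "f (?n - l) = f l"
      unfolding f_def by (simp only: sin_minus)
  qed auto
  finally show ?thesis
    by (simp add: f_def add_ac)
qed

text \<open>Column \<open>l\<close> of \<^const>\<open>B_odd\<close> lists the negatives of the coefficients of the preceding expansion
  in order of increasing multiples of \<open>t\<close>.\<close>

lemma B_odd_sin:
  assumes "l < m"
  shows "(\<Sum>i<m. B_odd m $$ (i, l) * sin ((2 * real i + 1) * t)) = - ((- 4 * (sin t)\<^sup>2) ^ l * sin t)"
proof -
  have "(\<Sum>i<m. B_odd m $$ (i, l) * sin ((2 * real i + 1) * t))
      = (\<Sum>i\<le>l. B_odd m $$ (i, l) * sin ((2 * real i + 1) * t))"
    using assms by (intro sum.mono_neutral_right) (auto simp: B_odd_def entry_mat_def)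
  also have "\<dots> = (\<Sum>d\<le>l. - ((- 1) ^ d * real ((2 * l + 1) choose d) * sin (real_of_int (2 * int l + 1 - 2 * int d) * t)))"
  proof (rule sum.reindex_bij_witness[of _ "\<lambda>d. l - d" "\<lambda>i. l - i"])
    fix i assume "i \<in> {..l}"
    then have "i \<le> l" by simp
    then obtain d where d: "l = i + d"
      using le_Suc_ex by blast
    have "(- 1 :: real) ^ (i + l + 1) = - ((- 1) ^ d)"
      by (simp add: d minus_one_power_iff)
    moreover have "real_of_int (2 * int l + 1 - 2 * int d) = 2 * real i + 1"
      by (simp add: d)
    ultimately show "- ((- 1) ^ (l - i) * real ((2 * l + 1) choose (l - i)) * sin (real_of_int (2 * int l + 1 - 2 * int (l - i)) * t))
        = B_odd m $$ (i, l) * sin ((2 * real i + 1) * t)"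
      using assms by (simp add: B_odd_def entry_mat_def d)
  qed auto
  also have "\<dots> = - ((- 4 * (sin t)\<^sup>2) ^ l * sin t)"
    by (simp only: sin_odd_power_fold sum_negf)
  finally show ?thesis .
qed

section \<open>Orthogonality of the sines at the nodes\<close>

lemma sum_cos_dirichlet: "2 * sin y * (\<Sum>k=1..m. cos (2 * real k * y)) = sin ((2 * real m + 1) * y) - sin (y::real)"
proof (induction m)
  case (Suc m)
  have "sin ((2 * real (Suc m) + 1) * y) = sin (2 * real (Suc m) * y + y)"
    "sin ((2 * real m + 1) * y) = sin (2 * real (Suc m) * y - y)"
    by (simp_all add: algebra_simps)
  then have "sin ((2 * real (Suc m) + 1) * y) - sin ((2 * real m + 1) * y) = 2 * sin y * cos (2 * real (Suc m) * y)"
    by (simp only: sin_add sin_diff) simp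
  then show ?case
    using Suc by (simp add: distrib_left)
qed simp

text \<open>Exchanging the roles of \<open>n\<close> and \<open>k\<close> in \<open>n * node m k\<close> makes the sum a Dirichlet kernel at
  \<open>n * pi / (2 * m + 1)\<close>, where its numerator \<open>sin (n * pi)\<close> vanishes.\<close>

lemma sum_cos_nodes:
  assumes "0 < n" "n \<le> 2 * m"
  shows "(\<Sum>k=1..m. cos (2 * real n * node m k)) = - 1 / 2"
proof -
  define y where "y = pi * real n / (2 * real m + 1)"
  have "pi * real n < pi * (2 * real m + 1)"
    using assms by (intro mult_strict_left_mono) auto
  then have "0 < y" "y < pi"
    using assms by (auto simp: y_def field_simps)
  then have "sin y > 0" by (rule sin_gt_zero)
  moreover have "(2 * real m + 1) * y = real n * pi"
    by (simp add: y_def)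
  moreover have "(\<Sum>k=1..m. cos (2 * real n * node m k)) = (\<Sum>k=1..m. cos (2 * real k * y))"
    by (simp add: y_def node_def mult_ac)
  ultimately have "sin y * (2 * (\<Sum>k=1..m. cos (2 * real n * node m k)) + 1) = 0"
    using sum_cos_dirichlet[of y m] by (simp add: distrib_left mult_ac)
  then show ?thesis
    using \<open>sin y > 0\<close> by simp
qed

text \<open>The product formula reduces this to two sums of cosines, with \<open>\<bar>i - j\<bar>\<close> and \<open>i + j - 1\<close> in the
  role of \<open>n\<close>. Both are at most \<open>2 * m\<close>, and only the first can be zero.\<close>

lemma sin_nodes_orthogonal:
  assumes "i \<in> {1..m}" "j \<in> {1..m}"
  shows "(\<Sum>k=1..m. sin ((2 * real i - 1) * node m k) * sin ((2 * real j - 1) * node m k))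
       = (if i = j then (2 * real m + 1) / 4 else 0)"
proof -
  have prod: "sin ((2 * real i - 1) * t) * sin ((2 * real j - 1) * t)
      = (cos (2 * real (max i j - min i j) * t) - cos (2 * real (i + j - 1) * t)) / 2" for t
  proof -
    have "cos (2 * real (max i j - min i j) * t) = cos ((2 * real i - 1) * t - (2 * real j - 1) * t)"
    proof (cases "i \<le> j")
      case True
      then have "2 * real (max i j - min i j) * t = - ((2 * real i - 1) * t - (2 * real j - 1) * t)"
        by (simp add: max_def min_def of_nat_diff algebra_simps)
      then show ?thesis by (simp only: cos_minus)
    next
      case False
      then show ?thesis
        by (simp add: max_def min_def of_nat_diff algebra_simps)
    qed
    moreover have "cos (2 * real (i + j - 1) * t) = cos ((2 * real i - 1) * t + (2 * real j - 1) * t)"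
      using assms by (simp add: of_nat_diff algebra_simps)
    ultimately show ?thesis
      by (simp only: cos_diff cos_add) simp
  qed
  have "(\<Sum>k=1..m. sin ((2 * real i - 1) * node m k) * sin ((2 * real j - 1) * node m k))
    = ((\<Sum>k=1..m. cos (2 * real (max i j - min i j) * node m k)) - (\<Sum>k=1..m. cos (2 * real (i + j - 1) * node m k))) / 2"
    unfolding prod by (simp only: sum_divide_distrib[symmetric] sum_subtractf)
  also have "(\<Sum>k=1..m. cos (2 * real (i + j - 1) * node m k)) = - 1 / 2"
    using assms by (intro sum_cos_nodes) auto
  also have "(\<Sum>k=1..m. cos (2 * real (max i j - min i j) * node m k)) = (if i = j then real m else - 1 / 2)"
  proof (cases "i = j")
    case False
    then have "0 < max i j - min i j" "max i j - min i j \<le> 2 * m"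
      using assms by auto
    then show ?thesis
      using False sum_cos_nodes[of "max i j - min i j" m] by simp
  qed simp
  finally show ?thesis
    by (cases "i = j") (simp_all add: field_simps)
qed

section \<open>The closed form and its dominant term\<close>

text \<open>The vector \<open>b\<close> below, the first column of \<open>B_odd m * R_mat m ^ r\<close>, satisfies
  \<open>(\<Sum>i=1..m. b (i - 1) * sin ((2 * i - 1) * t)) = - sin t / mu m k ^ r\<close> at each node \<open>t = node m k\<close>.
  Orthogonality solves this system for \<open>b\<close>.\<close>

lemma fibF_binet:
  assumes "j \<in> {1..m}"
  shows "fibF m (int r) j = (\<Sum>k=1..m. (mu m (int k * int j) - mu m (int k * (int j - 1))) / mu m (int k) ^ r)"
proof -
  define a where "a l = (R_mat m ^\<^sub>m r) $$ (l, 0)" for l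
  define b where "b i = (\<Sum>l<m. B_odd m $$ (i, l) * a l)" for i
  have carr: "B_odd m \<in> carrier_mat m m" "R_mat m \<in> carrier_mat m m" "R_mat m ^\<^sub>m r \<in> carrier_mat m m"
    by (auto simp: R_mat_def B_odd_def entry_mat_def intro!: pow_carrier_mat)
  have F: "fibF m (int r) j = (2 * real m + 1) * b (j - 1)"
  proof -
    have "j - 1 < m" "0 < m"
      using assms by auto
    moreover from this have "(B_odd m * R_mat m ^\<^sub>m r) $$ (j - 1, 0) = b (j - 1)"
      using carr by (simp add: a_def b_def scalar_prod_def atLeast0LessThan)
    ultimately show ?thesis
      using carr by (simp add: fibF_def mat_powi_def)
  qed
  have node_eq: "(\<Sum>i=1..m. b (i - 1) * sin ((2 * real i - 1) * node m k)) = - (sin (node m k) / mu m (int k) ^ r)"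
    if k: "k \<in> {1..m}" for k
  proof -
    have "(\<Sum>i=1..m. b (i - 1) * sin ((2 * real i - 1) * node m k)) = (\<Sum>i<m. b i * sin ((2 * real i + 1) * node m k))"
      by (rule sum.reindex_bij_witness[of _ Suc "\<lambda>i. i - 1"]) (auto simp: of_nat_diff algebra_simps)
    also have "\<dots> = (\<Sum>l<m. a l * (\<Sum>i<m. B_odd m $$ (i, l) * sin ((2 * real i + 1) * node m k)))"
      unfolding b_def sum_distrib_left sum_distrib_right by (subst sum.swap) (simp add: mult_ac)
    also have "\<dots> = - ((\<Sum>l<m. mu m (int k) ^ l * a l) * sin (node m k))"
    proof -
      have "(\<Sum>i<m. B_odd m $$ (i, l) * sin ((2 * real i + 1) * node m k)) = - (mu m (int k) ^ l * sin (node m k))"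
        if "l < m" for l
        using B_odd_sin[OF that] by (simp only: mu_eq_sin_node)
      then show ?thesis
        by (simp add: sum_distrib_left sum_negf mult_ac)
    qed
    also have "(\<Sum>l<m. mu m (int k) ^ l * a l) = 1 / mu m (int k) ^ r"
      using R_mat_power_left_eigenvector[of m "mu m (int k)" 0 r] h_sum_mu_eq_0[of k m] mu_neg[of k m] k
      by (simp add: a_def)
    finally show ?thesis
      by simp
  qed
  have "(\<Sum>k=1..m. (mu m (int k * int j) - mu m (int k * (int j - 1))) / mu m (int k) ^ r)
      = (\<Sum>k=1..m. 4 * (- (sin (node m k) / mu m (int k) ^ r)) * sin ((2 * real j - 1) * node m k))"
    unfolding mu_diff_eq_sin by (intro sum.cong) (auto simp: node_def)
  also have "\<dots> = (\<Sum>k=1..m. \<Sum>i=1..m. 4 * b (i - 1) * (sin ((2 * real i - 1) * node m k) * sin ((2 * real j - 1) * node m k)))"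
    by (intro sum.cong refl) (simp add: node_eq[symmetric] sum_distrib_left sum_distrib_right mult_ac)
  also have "\<dots> = (\<Sum>i=1..m. 4 * b (i - 1) * (if i = j then (2 * real m + 1) / 4 else 0))"
    by (subst sum.swap) (intro sum.cong refl, simp only: sum_distrib_left[symmetric] sin_nodes_orthogonal[OF _ assms])
  also have "\<dots> = (\<Sum>i=1..m. if i = j then (2 * real m + 1) * b (i - 1) else 0)"
    by (intro sum.cong) auto
  also have "\<dots> = (2 * real m + 1) * b (j - 1)"
    using assms by simp
  finally show ?thesis
    using F by simp
qed

lemma mu_dominant:
  assumes "2 \<le> k" "k \<le> m"
  shows "\<bar>mu m 1 / mu m (int k)\<bar> < 1"
proof -
  have "node m 1 < node m k"
    using assms by (simp add: node_def divide_strict_right_mono)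
  moreover have "0 < node m 1" "node m k < pi / 2"
    using node_bounds assms by auto
  ultimately have "0 < sin (node m 1)" "sin (node m 1) < sin (node m k)"
    by (auto intro!: sin_gt_zero sin_monotone_2pi)
  then have "(sin (node m 1))\<^sup>2 < (sin (node m k))\<^sup>2"
    by (intro power_strict_mono) auto
  then have "\<bar>mu m 1\<bar> < \<bar>mu m (int k)\<bar>"
    using mu_eq_sin_node[of m 1] by (simp add: mu_eq_sin_node)
  then show ?thesis
    by (simp add: abs_divide divide_less_eq)
qed

lemma fibF_scaled_tendsto:
  assumes j: "j \<in> {1..m}"
  shows "(\<lambda>r. fibF m (int r) j * mu m 1 ^ r) \<longlonglongrightarrow> mu m (int j) - mu m (int j - 1)"
proof -
  define d where "d k = mu m (int k * int j) - mu m (int k * (int j - 1))" for k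
  have "fibF m (int r) j * mu m 1 ^ r = d 1 + (\<Sum>k=2..m. d k * (mu m 1 / mu m (int k)) ^ r)" for r
  proof -
    have "fibF m (int r) j * mu m 1 ^ r = (\<Sum>k=1..m. d k * (mu m 1 / mu m (int k)) ^ r)"
      unfolding fibF_binet[OF j] d_def sum_distrib_right by (simp add: power_divide)
    also have "\<dots> = d 1 * (mu m 1 / mu m 1) ^ r + (\<Sum>k=2..m. d k * (mu m 1 / mu m (int k)) ^ r)"
      using j by (subst sum.atLeast_Suc_atMost) (auto simp: numeral_2_eq_2)
    finally show ?thesis
      using mu_neg[of 1 m] j by simp
  qed
  moreover have "(\<lambda>r. d 1 + (\<Sum>k=2..m. d k * (mu m 1 / mu m (int k)) ^ r)) \<longlonglongrightarrow> d 1 + (\<Sum>k=2..m. d k * 0)"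
    by (intro tendsto_intros LIMSEQ_power_zero) (use mu_dominant in auto)
  ultimately show ?thesis
    by (simp add: d_def)
qed

section \<open>The limit vector\<close>

lemma mu_consecutive:
  "mu m j - mu m (j - 1) = - 4 * sin (node m 1) * sin ((2 * of_int j - 1) * node m 1)"
  using mu_diff_eq_sin[of m 1 j] by (simp add: node_def)

text \<open>For \<open>1 \<le> j \<le> m\<close> the angle \<open>(2 * j - 1) * pi / (2 * m + 1)\<close> lies strictly between 0 and \<open>pi\<close>.\<close>

lemma mu_consecutive_nonzero:
  assumes "j \<in> {1..m}"
  shows "mu m (int j) - mu m (int j - 1) \<noteq> 0"
proof -
  have m: "1 \<le> m"
    using assms by auto
  have "(2 * real j - 1) * pi < (2 * real m + 1) * pi"
    using assms by (intro mult_strict_right_mono) auto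
  then have "(2 * real j - 1) * node m 1 < pi"
    by (simp add: node_def field_simps)
  moreover have "0 < (2 * real j - 1) * node m 1"
    using node_bounds[of 1 m] m assms by (intro mult_pos_pos) auto
  ultimately have "0 < sin ((2 * real j - 1) * node m 1)"
    by (intro sin_gt_zero)
  moreover have "0 < sin (node m 1)"
    using node_bounds[of 1 m] m by (intro sin_gt_zero) auto
  ultimately show ?thesis
    unfolding mu_consecutive by simp
qed

lemma Psi_lim_denominator_nonzero:
  assumes "k \<in> {1..m}"
  shows "mu m (int m - int k + 1) - mu m (int m - int k) \<noteq> 0"
proof -
  have "m - k + 1 \<in> {1..m}" and "int m - int k = int (m - k + 1) - 1"
    using assms by auto
  then show ?thesis
    using mu_consecutive_nonzero[of "m - k + 1" m] by (simp only: diff_add_cancel simp_thms)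
qed

text \<open>With \<open>t = pi / (2 * m + 1)\<close> and \<open>u = 2 * k * t\<close> the angle in the denominator is \<open>pi - u\<close>, and the
  one in the numerator is \<open>pi - 2 * u\<close> in the first half of the index range and \<open>2 * u - pi\<close> in the
  second. The minus sign in the second half compensates for this change of sign.\<close>

lemma Psi_lim_eq_phi:
  assumes k: "k \<in> {1..m}"
  shows "Psi_lim m k = phi m (int k)"
proof -
  define t where "t = node m 1"
  define u where "u = 2 * real k * t"
  have N: "(2 * real m + 1) * t = pi"
    by (simp add: t_def node_def)
  have angle: "2 * pi * real k / (2 * real m + 1) = u"
    by (simp add: u_def t_def node_def)
  have den_angle: "(2 * of_int (int m - int k + 1) - 1) * t = pi - u"
    unfolding u_def N[symmetric] by (simp add: algebra_simps)
  have den: "mu m (int m - int k + 1) - mu m (int m - int k) = - 4 * sin t * sin u"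
    using mu_consecutive[of m "int m - int k + 1"] unfolding t_def[symmetric] den_angle by simp
  have nz: "- 4 * sin t * sin u \<noteq> 0"
    using Psi_lim_denominator_nonzero[OF k] unfolding den .
  show ?thesis
  proof (cases "k \<le> m div 2")
    case True
    have num_angle: "(2 * of_int (int m - 2 * int k + 1) - 1) * t = pi - 2 * u"
      unfolding u_def N[symmetric] by (simp add: algebra_simps)
    have "mu m (int m - 2 * int k + 1) - mu m (int m - 2 * int k) = - 4 * sin t * sin (2 * u)"
      using mu_consecutive[of m "int m - 2 * int k + 1"] unfolding t_def[symmetric] num_angle by simp
    then show ?thesis
      using True nz by (simp add: Psi_lim_def den phi_def angle sin_double)
  next
    case False
    have num_angle: "(2 * of_int (2 * int k - int m) - 1) * t = 2 * u - pi"
      unfolding u_def N[symmetric] by (simp add: algebra_simps)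
    have "mu m (2 * int k - int m) - mu m (2 * int k - int m - 1) = 4 * sin t * sin (2 * u)"
      using mu_consecutive[of m "2 * int k - int m"] unfolding t_def[symmetric] num_angle by simp
    then show ?thesis
      using False nz by (simp add: Psi_lim_def den phi_def angle sin_double)
  qed
qed

section \<open>Convergence of the quotients\<close>

lemma fibF_quotient_tendsto:
  assumes "i \<in> {1..m}" "j \<in> {1..m}"
  shows "(\<lambda>r. fibF m (int r) i / fibF m (int r) j)
    \<longlonglongrightarrow> (mu m (int i) - mu m (int i - 1)) / (mu m (int j) - mu m (int j - 1))"
proof -
  have "mu m 1 \<noteq> 0"
    using mu_neg[of 1 m] assms by auto
  then have "fibF m (int r) i / fibF m (int r) j = (fibF m (int r) i * mu m 1 ^ r) / (fibF m (int r) j * mu m 1 ^ r)" for r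
    by simp
  moreover have "(\<lambda>r. (fibF m (int r) i * mu m 1 ^ r) / (fibF m (int r) j * mu m 1 ^ r))
      \<longlonglongrightarrow> (mu m (int i) - mu m (int i - 1)) / (mu m (int j) - mu m (int j - 1))"
    using assms by (intro tendsto_divide fibF_scaled_tendsto mu_consecutive_nonzero)
  ultimately show ?thesis
    by simp
qed

lemma Psi_fibF_tendsto:
  assumes k: "k \<in> {1..m}"
  shows "(\<lambda>r. Psi m (fibF m) (int r) k) \<longlonglongrightarrow> Psi_lim m k"
proof (cases "k \<le> m div 2")
  case True
  then have "m - 2 * k + 1 \<in> {1..m}" "m - k + 1 \<in> {1..m}"
    and eqs: "int m - 2 * int k = int (m - 2 * k + 1) - 1" "int m - int k = int (m - k + 1) - 1"
    using k by auto
  then show ?thesis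
    using fibF_quotient_tendsto[of "m - 2 * k + 1" m "m - k + 1"] True
    unfolding Psi_def Psi_lim_def eqs by (simp only: if_True diff_add_cancel)
next
  case False
  then have "2 * k - m \<in> {1..m}" "m - k + 1 \<in> {1..m}"
    and eqs: "2 * int k - int m = int (2 * k - m)" "int m - int k = int (m - k + 1) - 1"
    using k by auto
  then show ?thesis
    using tendsto_minus[OF fibF_quotient_tendsto[of "2 * k - m" m "m - k + 1"]] False
    unfolding Psi_def Psi_lim_def eqs by (simp only: if_False diff_add_cancel minus_divide_left)
qed

lemma fibF_eventually_nonzero:
  assumes "j \<in> {1..m}"
  shows "\<forall>\<^sub>F r in sequentially. fibF m (int r) j \<noteq> 0"
proof -
  have "\<forall>\<^sub>F r in sequentially. fibF m (int r) j * mu m 1 ^ r \<noteq> 0"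
    using fibF_scaled_tendsto[OF assms] mu_consecutive_nonzero[OF assms] by (rule tendsto_imp_eventually_ne)
  then show ?thesis
    by eventually_elim simp
qed

lemma fibN_multiple:
  "\<exists>c. c \<noteq> 0 \<and> (\<forall>j. fibN m r j = c * fibF m r j)"
proof (intro exI conjI)
  show "(\<Prod>p\<in>prime_factors (2 * m + 1). real p ^ nat ((r - 1) div int ((p - 1) div 2))) \<noteq> 0"
    by (auto simp: prime_factors_dvd)
qed (simp add: fibN_def)

lemma Psi_fibN: "Psi m (fibN m) r = Psi m (fibF m) r"
proof -
  obtain c where "c \<noteq> 0" "\<And>j. fibN m r j = c * fibF m r j"
    using fibN_multiple[of m r] by blast
  then show ?thesis
    by (auto simp: Psi_def)
qed

section \<open>The limit polynomial\<close>

text \<open>Over the complex numbers both sides have degree \<open>2 * m\<close> and leading coefficient 1, and both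
  vanish at the \<open>2 * m\<close> roots of unity of order \<open>2 * m + 1\<close> other than 1. The real identity
  follows by evaluation at real arguments.\<close>

lemma prod_quadratic_phi:
  "(\<Prod>k=1..m. [:1, - phi m (int k), 1:]) = (\<Sum>i\<le>2 * m. monom 1 i)"
proof -
  define N where "N = 2 * m + 1"
  define A :: "complex poly" where "A = (\<Prod>k=1..m. [:1, - complex_of_real (phi m (int k)), 1:])"
  define B :: "complex poly" where "B = (\<Sum>i\<le>2 * m. monom 1 i)"
  define S where "S = {z :: complex. z ^ N = 1} - {1}"
  have deg_A: "degree A = 2 * m"
    unfolding A_def by (subst degree_prod_eq_sum_degree) auto
  have "lead_coeff A = 1"
    unfolding A_def by (subst lead_coeff_prod) simp
  then have "coeff A (2 * m) = coeff B (2 * m)"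
    by (simp add: deg_A B_def coeff_sum)
  moreover have "degree B \<le> 2 * m"
    unfolding B_def by (intro degree_sum_le) (auto intro: order.trans[OF degree_monom_le])
  moreover have "2 * m \<le> card S"
  proof -
    have "card {z :: complex. z ^ N = 1} = N"
      by (rule card_roots_unity_eq) (simp add: N_def)
    then have "card S = N - 1"
      unfolding S_def by (subst card_Diff_singleton) auto
    then show ?thesis
      by (simp add: N_def)
  qed
  moreover have "poly A z = poly B z" if "z \<in> S" for z
  proof -
    have z: "z ^ N = 1" "z \<noteq> 1"
      using that by (auto simp: S_def)
    have "(1 - z) * poly B z = 1 - z ^ N"
      using sum_gp_basic[of z "2 * m"] by (simp add: B_def N_def poly_sum poly_monom)
    then have B0: "poly B z = 0"
      using z by simp
    have "z \<in> (\<lambda>k. cis (2 * pi * real k / real N)) ` {..<N}"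
      using bij_betw_imp_surj_on[OF bij_betw_roots_unity[of N]] z by (simp add: N_def)
    then obtain k where k: "k < N" "z = cis (2 * pi * real k / real N)"
      by auto
    have "k \<noteq> 0"
      using k z by (intro notI) simp
    \<comment> \<open>\<open>z\<close> and its conjugate belong to the same factor; \<open>k'\<close> is the index of that factor.\<close>
    define k' where "k' = (if k \<le> m then k else N - k)"
    have "phi m (int k') = 2 * cos (2 * pi * real k / real N)"
    proof (cases "k \<le> m")
      case True
      then show ?thesis by (simp add: phi_def k'_def N_def add_ac)
    next
      case False
      have "2 * pi * real (N - k) / real N = 2 * pi - 2 * pi * real k / real N"
        using k by (simp add: of_nat_diff field_simps)
      then have "cos (2 * pi * real (N - k) / real N) = cos (2 * pi * real k / real N)"
        by (simp only: cos_diff cos_two_pi sin_two_pi)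
      then show ?thesis
        using False by (simp add: phi_def k'_def N_def add_ac)
    qed
    moreover have "poly [:1, - complex_of_real (2 * cos a), 1:] (cis a) = 0" for a
      using sin_cos_squared_add[of a] by (simp add: complex_eq_iff algebra_simps power2_eq_square)
    ultimately have "poly [:1, - complex_of_real (phi m (int k')), 1:] z = 0"
      by (simp only: k(2))
    moreover have "k' \<in> {1..m}"
      using \<open>k \<noteq> 0\<close> k(1) by (auto simp: k'_def N_def)
    ultimately have "poly A z = 0"
      unfolding A_def poly_prod by (intro prod_zero) auto
    then show ?thesis
      using B0 by simp
  qed
  ultimately have AB: "A = B"
    using deg_A by (intro poly_eqI_degree_lead_coeff[of A "2 * m" B S]) auto
  have "poly (\<Prod>k=1..m. [:1, - phi m (int k), 1:]) x = poly (\<Sum>i\<le>2 * m. monom 1 i) x" for x :: real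
  proof -
    have "complex_of_real (poly (\<Prod>k=1..m. [:1, - phi m (int k), 1:]) x) = poly A (complex_of_real x)"
      by (simp add: A_def poly_prod)
    also have "\<dots> = complex_of_real (poly (\<Sum>i\<le>2 * m. monom 1 i) x)"
      by (simp add: AB B_def poly_sum poly_monom)
    finally show ?thesis
      by (simp only: of_real_eq_iff)
  qed
  then show ?thesis
    using poly_eq_poly_eq_iff by blast
qed

section \<open>Coefficientwise and Euclidean convergence\<close>

lemma coeffwise_lim_prod:
  assumes "finite S" "\<And>k. k \<in> S \<Longrightarrow> coeffwise_lim (\<lambda>r. P r k) (Q k)"
  shows "coeffwise_lim (\<lambda>r. \<Prod>k\<in>S. P r k) (\<Prod>k\<in>S. Q k)"
  using assms
proof (induction S rule: finite_induct)
  case empty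
  then show ?case by (simp add: coeffwise_lim_def)
next
  case (insert k S)
  then show ?case
    by (auto simp: coeffwise_lim_def coeff_mult intro!: tendsto_sum tendsto_mult)
qed

lemma coeffwise_lim_quadratic:
  assumes "X \<longlonglongrightarrow> L"
  shows "coeffwise_lim (\<lambda>r. [:1, - X r, 1:]) [:1, - L, 1:]"
  using assms by (auto simp: coeffwise_lim_def coeff_pCons split: nat.split intro!: tendsto_intros)

lemma eucl_limI:
  assumes "\<And>k. k \<in> {1..m} \<Longrightarrow> (\<lambda>r. X r k) \<longlonglongrightarrow> L k"
  shows "eucl_lim m X L"
proof -
  have "(\<lambda>r. L2_set (\<lambda>k. X r k - L k) {1..m}) \<longlonglongrightarrow> sqrt (\<Sum>k=1..m. (L k - L k)\<^sup>2)"
    unfolding L2_set_def using assms by (intro tendsto_intros) auto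
  then show ?thesis
    by (simp add: eucl_lim_def)
qed

theorem theorem3:
  fixes m :: nat
  assumes "1 \<le> m"
  shows
    "(\<forall>k\<in>{1..m}. mu m (int m - int k + 1) - mu m (int m - int k) \<noteq> 0) \<and>
     (\<forall>k\<in>{1..m}. Psi_lim m k = phi m (int k)) \<and>
     (\<forall>\<^sub>F r in sequentially. \<forall>k\<in>{1..m}. fibF m (int r) (m - k + 1) \<noteq> 0) \<and>
     eucl_lim m (\<lambda>r. Psi m (fibF m) (int r)) (Psi_lim m) \<and>
     coeffwise_lim (\<lambda>r. \<Prod>k=1..m. [:1, - Psi m (fibF m) (int r) k, 1:])
       (\<Sum>i\<le>2 * m. monom 1 i) \<and>
     (\<forall>\<^sub>F r in sequentially. \<forall>k\<in>{1..m}. fibN m (int r) (m - k + 1) \<noteq> 0) \<and>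
     eucl_lim m (\<lambda>r. Psi m (fibN m) (int r)) (Psi_lim m) \<and>
     coeffwise_lim (\<lambda>r. \<Prod>k=1..m. [:1, - Psi m (fibN m) (int r) k, 1:])
       (\<Sum>i\<le>2 * m. monom 1 i)"
proof -
  have index: "m - k + 1 \<in> {1..m}" if "k \<in> {1..m}" for k
    using that by auto
  have nonzero: "\<forall>\<^sub>F r in sequentially. \<forall>k\<in>{1..m}. fibF m (int r) (m - k + 1) \<noteq> 0"
    using index fibF_eventually_nonzero by (intro eventually_ball_finite) auto
  have fibN_zero_iff: "fibN m r j = 0 \<longleftrightarrow> fibF m r j = 0" for r j
  proof -
    obtain c where "c \<noteq> 0" "\<And>j. fibN m r j = c * fibF m r j"
      using fibN_multiple[of m r] by blast
    then show ?thesis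
      by simp
  qed
  have eucl: "eucl_lim m (\<lambda>r. Psi m (fibF m) (int r)) (Psi_lim m)"
    by (intro eucl_limI Psi_fibF_tendsto)
  have "coeffwise_lim (\<lambda>r. \<Prod>k=1..m. [:1, - Psi m (fibF m) (int r) k, 1:]) (\<Prod>k=1..m. [:1, - Psi_lim m k, 1:])"
    by (intro coeffwise_lim_prod coeffwise_lim_quadratic Psi_fibF_tendsto) auto
  also have "(\<Prod>k=1..m. [:1, - Psi_lim m k, 1:]) = (\<Prod>k=1..m. [:1, - phi m (int k), 1:])"
    by (intro prod.cong) (auto simp: Psi_lim_eq_phi)
  finally have "coeffwise_lim (\<lambda>r. \<Prod>k=1..m. [:1, - Psi m (fibF m) (int r) k, 1:]) (\<Sum>i\<le>2 * m. monom 1 i)"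
    unfolding prod_quadratic_phi .
  then show ?thesis
    unfolding Psi_fibN fibN_zero_iff using Psi_lim_denominator_nonzero Psi_lim_eq_phi nonzero eucl by blast
qed

end
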